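(* Let $\mathrm{GV}\in H^3(\mathrm{D}^\infty\mathrm{W}_1)$ be the class of $h_{(0)}c_{(0)}$ and let $F_{0,5}$ be the $0$-eigenspace of $\delta\circ\sigma$ on the order-$5$ part of $H^*(\mathrm{D}^\infty\mathrm{W}_1)$. The classes $\delta(\mathrm{GV})\,\delta^4(\mathrm{GV})$ and $\delta^2(\mathrm{GV})\,\delta^3(\mathrm{GV})$ belong to $F_{0,5}$ and are proportional to the class of $h_{(1)}h_{(2)}c_{(0)}c_{(2)}$, which is non-trivial. In particular, the product structure of $H^*(\mathrm{D}^\infty\mathrm{W}_1)$ is non-trivial (i.e. these products are non-zero).
   Context: Let $\widetilde{\mathrm{D}^\infty\mathrm{W}}_1=\bigwedge[h_{(i)}]_{i\ge0}\otimes\mathbb{R}[c_{(j)}]_{j\ge0}$, with $h_{(i)}$ odd of degree 1, $c_{(j)}$ even of degree 2, and differential (signed derivation) $dh_{(i)}=c_{(i)}$, $dc_{(i)}=0$. The order is the additive grading with $\mathrm{ord}(h_{(i)})=\mathrm{ord}(c_{(i)})=i$. Let $\widetilde\delta,\widetilde\sigma$ be the unsigned derivations with $\widetilde\delta(c_{(i)})=c_{(i+1)}$, $\widetilde\delta(h_{(i)})=h_{(i+1)}$, $\widetilde\sigma(c_{(i)})=\frac12i(i-1)c_{(i-1)}$, $\widetilde\sigma(h_{(i)})=\frac12i(i-1)h_{(i-1)}$ (zero for $i=0$). Set $\mathrm{D}^\infty\mathrm{W}_1=\widetilde{\mathrm{D}^\infty\mathrm{W}}_1/\mathscr{I}$,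 where $\mathscr{I}$ is the ideal generated by $\widetilde\delta^k(c_{(0)}^2)$, $k\ge0$. The derivations $\widetilde\delta,\widetilde\sigma$ preserve $\mathscr{I}$ and commute with $d$; they induce derivations $\delta,\sigma$ of $H^*(\mathrm{D}^\infty\mathrm{W}_1)$. *)

theory Defs
  imports Complex_Main "HOL-Library.FSet" "HOL-Library.Multiset"
begin

text \<open>
  The free graded-commutative algebra (called \<open>dwt\<close> below) on the odd generators
  \<open>h\<^bsub>(i)\<^esub>\<close> and the even generators \<open>c\<^bsub>(i)\<^esub>\<close> is realised on its
  monomial basis: the pair \<open>(A, M)\<close>, with \<open>A = {a\<^sub>1 < ... < a\<^sub>k}\<close> a finite set and
  \<open>M = {# m\<^sub>1, ..., m\<^sub>l #}\<close> a finite multiset, stands for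
  \<open>h\<^bsub>(a\<^sub>1)\<^esub> ... h\<^bsub>(a\<^sub>k)\<^esub> c\<^bsub>(m\<^sub>1)\<^esub> ... c\<^bsub>(m\<^sub>l)\<^esub>\<close>.
  Suffix \<open>t\<close> marks what lives on this algebra (where the mathematics has a tilde), \<open>dw\<close> is its
  quotient by the ideal generated by the \<open>deltat\<^sup>k (c\<^bsub>(0)\<^esub>\<^sup>2)\<close>, and \<open>hdw\<close> is
  the cohomology of \<open>dw\<close>.
\<close>

type_synonym monom = "nat fset \<times> nat multiset"

typedef dwt = "{f :: monom \<Rightarrow> real. finite {m. f m \<noteq> 0}}"
  morphisms coeff Abs_dwt
  by (rule exI[of _ "\<lambda>_. 0"]) simp

setup_lifting type_definition_dwt

lemma finite_supp [simp]: "finite {m. coeff x m \<noteq> 0}"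
  using coeff[of x] by simp

lemma dwt_eqI: "(\<And>m. coeff x m = coeff y m) \<Longrightarrow> x = y"
  by (metis coeff_inject ext)

instantiation dwt :: real_vector
begin

lift_definition zero_dwt :: dwt is "\<lambda>_. 0" by simp
lift_definition plus_dwt :: "dwt \<Rightarrow> dwt \<Rightarrow> dwt" is "\<lambda>f g m. f m + g m"
proof -
  fix f g :: "monom \<Rightarrow> real"
  assume "finite {m. f m \<noteq> 0}" "finite {m. g m \<noteq> 0}"
  then show "finite {m. f m + g m \<noteq> 0}"
    by (rule_tac finite_subset[of _ "{m. f m \<noteq> 0} \<union> {m. g m \<noteq> 0}"]) auto
qed
lift_definition uminus_dwt :: "dwt \<Rightarrow> dwt" is "\<lambda>f m. - f m" by simp
lift_definition minus_dwt :: "dwt \<Rightarrow> dwt \<Rightarrow> dwt" is "\<lambda>f g m. f m - g m"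
proof -
  fix f g :: "monom \<Rightarrow> real"
  assume "finite {m. f m \<noteq> 0}" "finite {m. g m \<noteq> 0}"
  then show "finite {m. f m - g m \<noteq> 0}"
    by (rule_tac finite_subset[of _ "{m. f m \<noteq> 0} \<union> {m. g m \<noteq> 0}"]) auto
qed
lift_definition scaleR_dwt :: "real \<Rightarrow> dwt \<Rightarrow> dwt" is "\<lambda>r f m. r * f m"
  by (rule_tac finite_subset) auto

instance
  by standard (transfer; auto simp: algebra_simps fun_eq_iff)+

end

lemma coeff_zero [simp]: "coeff 0 m = 0" by (simp add: zero_dwt.rep_eq)
lemma coeff_add [simp]: "coeff (x + y) m = coeff x m + coeff y m" by (simp add: plus_dwt.rep_eq)
lemma coeff_scaleR [simp]: "coeff (r *\<^sub>R x) m = r * coeff x m" by (simp add: scaleR_dwt.rep_eq)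
lemma coeff_uminus [simp]: "coeff (- x) m = - coeff x m" by (simp add: uminus_dwt.rep_eq)
lemma coeff_diff [simp]: "coeff (x - y) m = coeff x m - coeff y m" by (simp add: minus_dwt.rep_eq)
lemma coeff_sum [simp]: "coeff (\<Sum>i\<in>I. x i) m = (\<Sum>i\<in>I. coeff (x i) m)"
  by (induction I rule: infinite_finite_induct) auto

lift_definition monomial :: "monom \<Rightarrow> dwt" is "\<lambda>m n. if n = m then 1 else 0"
  by (rule_tac finite_subset) (auto split: if_splits)

lemma coeff_mono: "coeff (monomial m) n = (if n = m then 1 else 0)"
  by (simp add: monomial.rep_eq)

definition lin :: "(monom \<Rightarrow> 'a::real_vector) \<Rightarrow> dwt \<Rightarrow> 'a" where
  "lin f x = (\<Sum>m | coeff x m \<noteq> 0. coeff x m *\<^sub>R f m)"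

lemma lin_superset:
  "finite S \<Longrightarrow> {m. coeff x m \<noteq> 0} \<subseteq> S \<Longrightarrow> lin f x = (\<Sum>m\<in>S. coeff x m *\<^sub>R f m)"
  unfolding lin_def by (rule sum.mono_neutral_left) auto

lemma linear_lin: "linear (lin f)"
proof (rule linearI)
  fix x y :: dwt and r :: real
  let ?S = "{m. coeff x m \<noteq> 0} \<union> {m. coeff y m \<noteq> 0}"
  have S: "finite ?S" by simp
  have "lin f (x + y) = (\<Sum>m\<in>?S. coeff (x + y) m *\<^sub>R f m)"
    by (rule lin_superset[OF S]) auto
  also have "\<dots> = (\<Sum>m\<in>?S. coeff x m *\<^sub>R f m) + (\<Sum>m\<in>?S. coeff y m *\<^sub>R f m)"
    by (simp add: scaleR_left_distrib sum.distrib)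
  also have "\<dots> = lin f x + lin f y"
    by (intro arg_cong2[of _ _ _ _ "(+)"] lin_superset[OF S, symmetric]) auto
  finally show "lin f (x + y) = lin f x + lin f y" .
  have "lin f (r *\<^sub>R x) = (\<Sum>m | coeff x m \<noteq> 0. coeff (r *\<^sub>R x) m *\<^sub>R f m)"
    by (rule lin_superset) auto
  then show "lin f (r *\<^sub>R x) = r *\<^sub>R lin f x"
    by (simp add: lin_def scaleR_sum_right)
qed

lemma lin_mono [simp]: "lin f (monomial m) = f m"
proof -
  have "{n. coeff (monomial m) n \<noteq> 0} = {m}" by (auto simp: coeff_mono)
  then show ?thesis by (simp add: lin_def coeff_mono)
qed

lemma dwt_expand: "x = (\<Sum>m | coeff x m \<noteq> 0. coeff x m *\<^sub>R monomial m)"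
  by (rule dwt_eqI) (auto simp: coeff_mono if_distrib sum.delta cong: if_cong)

lemma linear_eq_mono:
  assumes "linear f" "linear g" "\<And>m. f (monomial m) = g (monomial m)"
  shows "f x = g x"
proof -
  have "f (\<Sum>m | coeff x m \<noteq> 0. coeff x m *\<^sub>R monomial m) = g (\<Sum>m | coeff x m \<noteq> 0. coeff x m *\<^sub>R monomial m)"
    by (simp add: linear_sum[OF assms(1)] linear_sum[OF assms(2)] linear_scale[OF assms(1)]
        linear_scale[OF assms(2)] assms(3))
  then show ?thesis using dwt_expand[of x] by simp
qed

text \<open>
  \<open>ksign A B\<close> is the Koszul sign of sorting \<open>h\<^sub>A h\<^sub>B\<close>: the parity of the number of
  inversions.
\<close>

definition ninv :: "nat set \<Rightarrow> nat set \<Rightarrow> nat" where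
  "ninv A B = card {(a, b). a \<in> A \<and> b \<in> B \<and> b < a}"

definition ksign :: "nat set \<Rightarrow> nat set \<Rightarrow> real" where
  "ksign A B = (-1) ^ ninv A B"

fun mmul :: "monom \<Rightarrow> monom \<Rightarrow> dwt" where
  "mmul (A, M) (B, N) =
     (if A |\<inter>| B = {||} then ksign (fset A) (fset B) *\<^sub>R monomial (A |\<union>| B, M + N) else 0)"

lemma finite_inv [simp]:
  "finite A \<Longrightarrow> finite B \<Longrightarrow> finite {(a, b). a \<in> A \<and> b \<in> B \<and> b < (a::nat)}"
  by (rule finite_subset[of _ "A \<times> B"]) auto

lemma ninv_Un1:
  assumes "finite A" "finite B" "finite C" "A \<inter> B = {}"
  shows "ninv (A \<union> B) C = ninv A C + ninv B C"
proof -
  have eq: "{(a, b). a \<in> A \<union> B \<and> b \<in> C \<and> b < a} =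
    {(a, b). a \<in> A \<and> b \<in> C \<and> b < a} \<union> {(a, b). a \<in> B \<and> b \<in> C \<and> b < a}" by auto
  show ?thesis unfolding ninv_def eq
    by (rule card_Un_disjoint) (use assms in auto)
qed

lemma ninv_Un2:
  assumes "finite A" "finite B" "finite C" "A \<inter> B = {}"
  shows "ninv C (A \<union> B) = ninv C A + ninv C B"
proof -
  have eq: "{(a, b). a \<in> C \<and> b \<in> A \<union> B \<and> b < a} =
    {(a, b). a \<in> C \<and> b \<in> A \<and> b < a} \<union> {(a, b). a \<in> C \<and> b \<in> B \<and> b < a}" by auto
  show ?thesis unfolding ninv_def eq
    by (rule card_Un_disjoint) (use assms in auto)
qed

lemma ksign_Un1: "finite C \<Longrightarrow> A |\<inter>| B = {||} \<Longrightarrow>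
    ksign (fset A \<union> fset B) C = ksign (fset A) C * ksign (fset B) C"
  unfolding ksign_def
  by (subst ninv_Un1) (auto simp: power_add simp flip: inf_fset.rep_eq)

lemma ksign_Un2: "finite C \<Longrightarrow> A |\<inter>| B = {||} \<Longrightarrow>
    ksign C (fset A \<union> fset B) = ksign C (fset A) * ksign C (fset B)"
  unfolding ksign_def
  by (subst ninv_Un2) (auto simp: power_add simp flip: inf_fset.rep_eq)

lemma ksign_empty [simp]: "ksign {} B = 1" "ksign A {} = 1"
  by (simp_all add: ksign_def ninv_def)

instantiation dwt :: real_algebra_1
begin

definition times_dwt :: "dwt \<Rightarrow> dwt \<Rightarrow> dwt" where
  "x * y = lin (\<lambda>m. lin (\<lambda>n. mmul m n) y) x"

definition one_dwt :: dwt where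
  "1 = monomial ({||}, {#})"

lemma times_linear1: "linear (\<lambda>x. x * y)" for y :: dwt
  unfolding times_dwt_def by (rule linear_lin)

lemma times_linear2: "linear (\<lambda>y. x * y)" for x :: dwt
proof (rule linearI)
  fix y z :: dwt and r :: real
  show "x * (y + z) = x * y + x * z" "x * (r *\<^sub>R y) = r *\<^sub>R (x * y)"
    unfolding times_dwt_def linear_add[OF linear_lin] linear_scale[OF linear_lin]
    by (simp_all add: lin_def scaleR_right_distrib sum.distrib scaleR_sum_right mult.left_commute)
qed

lemma monomial_times: "monomial m * monomial n = mmul m n"
  by (simp add: times_dwt_def)

lemma assoc_mono: "monomial a * monomial b * monomial c = monomial a * (monomial b * monomial c)"
proof -
  obtain A M B N C K where [simp]: "a = (A, M)" "b = (B, N)" "c = (C, K)"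
    by (metis surj_pair)
  note s = linear_scale[OF times_linear1] linear_scale[OF times_linear2]
    linear_0[OF times_linear1] linear_0[OF times_linear2]
  show ?thesis
  proof (cases "A |\<inter>| B = {||} \<and> B |\<inter>| C = {||} \<and> A |\<inter>| C = {||}")
    case True
    then have "(A |\<union>| B) |\<inter>| C = {||}" "A |\<inter>| (B |\<union>| C) = {||}"
      by (simp_all add: inf_sup_distrib1 inf_sup_distrib2)
    then show ?thesis using True
      by (simp add: monomial_times s ksign_Un1 ksign_Un2 algebra_simps sup_assoc)
  next
    case False
    then show ?thesis
      by (auto simp: monomial_times s inf_sup_distrib1 inf_sup_distrib2)
  qed
qed

lemma linear_timesR: "linear f \<Longrightarrow> linear (\<lambda>x. f x * y)" for f :: "'a::real_vector \<Rightarrow> dwt" and y :: dwt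
  using linear_compose[OF _ times_linear1, of f y] by (simp add: o_def)

lemma linear_timesL: "linear f \<Longrightarrow> linear (\<lambda>x. y * f x)" for f :: "'a::real_vector \<Rightarrow> dwt" and y :: dwt
  using linear_compose[OF _ times_linear2, of f y] by (simp add: o_def)

instance
proof
  fix x y z :: dwt and r :: real
  show "(x + y) * z = x * z + y * z" by (rule linear_add[OF times_linear1])
  show "x * (y + z) = x * y + x * z" by (rule linear_add[OF times_linear2])
  show "r *\<^sub>R x * y = r *\<^sub>R (x * y)" by (rule linear_scale[OF times_linear1])
  show "x * r *\<^sub>R y = r *\<^sub>R (x * y)" by (rule linear_scale[OF times_linear2])
  show "1 * x = x"
    by (rule linear_eq_mono[OF times_linear2 linear_ident])
      (auto simp: one_dwt_def monomial_times)
  show "x * 1 = x"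
    by (rule linear_eq_mono[OF times_linear1 linear_ident])
      (auto simp: one_dwt_def monomial_times)
  show "(0::dwt) \<noteq> 1"
    by (metis coeff_mono coeff_zero one_dwt_def zero_neq_one)
  show "x * y * z = x * (y * z)"
  proof (rule linear_eq_mono[of "\<lambda>x. x * y * z" "\<lambda>x. x * (y * z)"])
    fix a show "monomial a * y * z = monomial a * (y * z)"
    proof (rule linear_eq_mono[of "\<lambda>y. monomial a * y * z" "\<lambda>y. monomial a * (y * z)"])
      fix b show "monomial a * monomial b * z = monomial a * (monomial b * z)"
        by (rule linear_eq_mono[of "\<lambda>z. monomial a * monomial b * z" "\<lambda>z. monomial a * (monomial b * z)"])
          (auto intro!: linear_timesL linear_timesR linear_ident assoc_mono)
    qed (intro linear_timesL linear_timesR linear_ident)+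
  qed (intro linear_timesL linear_timesR linear_ident)+
qed

end


lemma ksign_square [simp]: "ksign A B * ksign A B = 1" "ksign A B * (ksign A B * z) = z"
  by (simp_all add: ksign_def flip: mult.assoc power_add)

lemma ksign_insert1: "finite A \<Longrightarrow> finite B \<Longrightarrow> i \<notin> A \<Longrightarrow> ksign (insert i A) B = ksign {i} B * ksign A B"
  unfolding ksign_def using ninv_Un1[of "{i}" A B] by (simp add: power_add)

lemma ksign_insert2: "finite A \<Longrightarrow> finite B \<Longrightarrow> i \<notin> A \<Longrightarrow> ksign B (insert i A) = ksign B {i} * ksign B A"
  unfolding ksign_def using ninv_Un2[of "{i}" A B] by (simp add: power_add)

lemma ksign_refl [simp]: "ksign {i} {i} = 1"
proof -
  have "{(a, b). a \<in> {i} \<and> b \<in> {i} \<and> b < a} = {}" by auto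
  then show ?thesis by (simp add: ksign_def ninv_def del: Collect_empty_eq)
qed

lemma ksign_swap: "finite A \<Longrightarrow> i \<notin> A \<Longrightarrow> ksign A {i} = (-1) ^ card A * ksign {i} A"
proof (induction A rule: finite_induct)
  case (insert a A)
  have "ksign {a} {i} = - ksign {i} {a}"
  proof (cases "a < i")
    case True
    then have "{(x, b). x \<in> {a} \<and> b \<in> {i} \<and> b < x} = {}"
       "{(x, b). x \<in> {i} \<and> b \<in> {a} \<and> b < x} = {(i, a)}" by auto
    then show ?thesis by (simp add: ksign_def ninv_def del: Collect_empty_eq)
  next
    case False
    with insert have "i < a" by auto
    then have "{(x, b). x \<in> {i} \<and> b \<in> {a} \<and> b < x} = {}"
       "{(x, b). x \<in> {a} \<and> b \<in> {i} \<and> b < x} = {(a, i)}" by auto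
    then show ?thesis by (simp add: ksign_def ninv_def del: Collect_empty_eq)
  qed
  with insert show ?case by (simp add: ksign_insert1[of A] ksign_insert2[of A])
qed simp

definition h :: "nat \<Rightarrow> dwt" where "h i = monomial ({|i|}, {#})"
definition c :: "nat \<Rightarrow> dwt" where "c i = monomial ({||}, {#i#})"

text \<open>
  The parity involution, and the partial derivatives with respect to \<open>h\<^bsub>(i)\<^esub>\<close>
  (a signed derivation) and \<open>c\<^bsub>(i)\<^esub>\<close>.
\<close>

definition par :: "dwt \<Rightarrow> dwt" where
  "par = lin (\<lambda>(A, M). (-1) ^ fcard A *\<^sub>R monomial (A, M))"

definition dh :: "nat \<Rightarrow> dwt \<Rightarrow> dwt" where
  "dh i = lin (\<lambda>(A, M). if i |\<in>| A then ksign {i} (fset A) *\<^sub>R monomial (A |-| {|i|}, M) else 0)"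

definition dc :: "nat \<Rightarrow> dwt \<Rightarrow> dwt" where
  "dc i = lin (\<lambda>(A, M). real (count M i) *\<^sub>R monomial (A, M - {#i#}))"

text \<open>
  \<open>der f g = \<Sum>i. f i \<sqdot> \<partial>/\<partial>h\<^bsub>(i)\<^esub> + g i \<sqdot> \<partial>/\<partial>c\<^bsub>(i)\<^esub>\<close> is the derivation with
  \<open>h\<^bsub>(i)\<^esub> \<mapsto> f i\<close> and \<open>c\<^bsub>(i)\<^esub> \<mapsto> g i\<close>: an unsigned one when every \<open>f i\<close> is odd and every
  \<open>g i\<close> is even, a signed one when the parities are the other way round (see \<open>der_mult\<close> below).
\<close>

definition der :: "(nat \<Rightarrow> dwt) \<Rightarrow> (nat \<Rightarrow> dwt) \<Rightarrow> dwt \<Rightarrow> dwt" where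
  "der f g = lin (\<lambda>(A, M). (\<Sum>i\<in>fset A. f i * dh i (monomial (A, M)))
                         + (\<Sum>i\<in>set_mset M. g i * dc i (monomial (A, M))))"

lemma linear_par: "linear par" and linear_dh: "linear (dh i)" and linear_dc: "linear (dc i)"
  and linear_der: "linear (der f g)"
  by (simp_all add: par_def dh_def dc_def der_def linear_lin)

lemma linear_lin_comp: "linear f \<Longrightarrow> linear g \<Longrightarrow> linear (\<lambda>x. f (g x))"
  using linear_compose[of g f] by (simp add: o_def)

lemmas linear_intros = linear_timesL linear_timesR linear_ident linear_compose_add
  linear_compose_sub linear_compose_neg
  linear_lin_comp[OF linear_par] linear_lin_comp[OF linear_dh] linear_lin_comp[OF linear_dc]
  linear_lin_comp[OF linear_der]

lemmas lin_simps [simp] =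
  linear_add[OF linear_par] linear_scale[OF linear_par] linear_0[OF linear_par] linear_diff[OF linear_par] linear_neg[OF linear_par]
  linear_add[OF linear_dh] linear_scale[OF linear_dh] linear_0[OF linear_dh] linear_diff[OF linear_dh] linear_neg[OF linear_dh]
  linear_add[OF linear_dc] linear_scale[OF linear_dc] linear_0[OF linear_dc] linear_diff[OF linear_dc] linear_neg[OF linear_dc]
  linear_add[OF linear_der] linear_scale[OF linear_der] linear_0[OF linear_der] linear_diff[OF linear_der] linear_neg[OF linear_der]

lemma par_mono [simp]: "par (monomial (A, M)) = (-1) ^ fcard A *\<^sub>R monomial (A, M)"
  by (simp add: par_def)

lemma dh_mono: "dh i (monomial (A, M)) =
    (if i |\<in>| A then ksign {i} (fset A) *\<^sub>R monomial (A |-| {|i|}, M) else 0)"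
  by (simp add: dh_def)

lemma dc_mono: "dc i (monomial (A, M)) = real (count M i) *\<^sub>R monomial (A, M - {#i#})"
  by (simp add: dc_def)

lemma par_par [simp]: "par (par x) = x"
  by (rule linear_eq_mono[of "\<lambda>x. par (par x)"])
    (auto intro!: linear_intros linear_par simp flip: power_add)

lemma bilinear_eq_mono:
  fixes F G :: "dwt \<Rightarrow> dwt \<Rightarrow> dwt"
  assumes "\<And>y. linear (\<lambda>x. F x y)" "\<And>y. linear (\<lambda>x. G x y)"
    "\<And>x. linear (\<lambda>y. F x y)" "\<And>x. linear (\<lambda>y. G x y)"
    "\<And>A M B N. F (monomial (A, M)) (monomial (B, N)) = G (monomial (A, M)) (monomial (B, N))"
  shows "F x y = G x y"
proof (rule linear_eq_mono[of "\<lambda>x. F x y" "\<lambda>x. G x y"])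
  fix m show "F (monomial m) y = G (monomial m) y"
  proof (rule linear_eq_mono[of "F (monomial m)" "G (monomial m)"])
    fix n show "F (monomial m) (monomial n) = G (monomial m) (monomial n)"
      using assms(5) by (cases m; cases n) simp
  qed (use assms in auto)
qed (use assms in auto)

lemma par_mult: "par (x * y) = par x * par y"
proof (rule bilinear_eq_mono[of "\<lambda>x y. par (x * y)" "\<lambda>x y. par x * par y"])
  fix A B :: "nat fset" and M N :: "nat multiset"
  show "par (monomial (A, M) * monomial (B, N)) = par (monomial (A, M)) * par (monomial (B, N))"
    by (auto simp: monomial_times fcard_funion_disjoint power_add)
qed (intro linear_intros)+

lemma h_commute: "h i * x = par x * h i"
proof (rule linear_eq_mono[of "\<lambda>x. h i * x" "\<lambda>x. par x * h i"])
  fix m :: monom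
  obtain A M where m: "m = (A, M)" by (cases m)
  show "h i * monomial m = par (monomial m) * h i"
    by (auto simp: h_def monomial_times m ksign_swap fcard.rep_eq simp flip: power_add mult.assoc)
qed (intro linear_intros linear_par)+

lemma c_commute: "c i * x = x * c i"
proof (rule linear_eq_mono[of "\<lambda>x. c i * x" "\<lambda>x. x * c i"])
  fix m :: monom
  obtain A M where m: "m = (A, M)" by (cases m)
  show "c i * monomial m = monomial m * c i"
    by (auto simp: c_def monomial_times m)
qed (intro linear_intros linear_par)+

lemma dh_mult: "dh i (x * y) = dh i x * y + par x * dh i y"
proof (rule bilinear_eq_mono[of "\<lambda>x y. dh i (x * y)" "\<lambda>x y. dh i x * y + par x * dh i y"])
  fix A B :: "nat fset" and M N :: "nat multiset"
  consider "i |\<notin>| A" "i |\<notin>| B" | A' where "i |\<notin>| A'" "A = finsert i A'" "i |\<notin>| B"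
    | B' where "i |\<notin>| B'" "B = finsert i B'" "i |\<notin>| A"
    | A' B' where "i |\<notin>| A'" "A = finsert i A'" "i |\<notin>| B'" "B = finsert i B'"
    by (metis mk_disjoint_finsert)
  then show "dh i (monomial (A, M) * monomial (B, N)) =
     dh i (monomial (A, M)) * monomial (B, N) + par (monomial (A, M)) * dh i (monomial (B, N))"
  proof cases
    case 1
    then show ?thesis by (simp add: monomial_times dh_mono)
  next
    case 2
    then have "(finsert i A' |-| {|i|}) = A'" "finsert i (A' |\<union>| B) |-| {|i|} = A' |\<union>| B" by auto
    with 2 show ?thesis
      by (cases "A' |\<inter>| B = {||}") (simp_all add: monomial_times dh_mono ksign_insert1[of "fset A'"] ksign_insert2[of "fset A'"] ksign_insert2[of "fset A' \<union> fset B"] ksign_Un1 ksign_Un2 mult_ac)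
  next
    case 3
    then have "(finsert i B' |-| {|i|}) = B'" "finsert i (A |\<union>| B') |-| {|i|} = A |\<union>| B'" by auto
    with 3 show ?thesis
      by (cases "A |\<inter>| B' = {||}") (simp_all add: monomial_times dh_mono ksign_insert1[of "fset B'"] ksign_insert2[of "fset B'"] ksign_insert2[of "fset A \<union> fset B'"] ksign_Un1 ksign_Un2 mult_ac
         ksign_swap fcard.rep_eq)
  next
    case 4
    then have "(finsert i A' |-| {|i|}) = A'" "(finsert i B' |-| {|i|}) = B'" by auto
    with 4 show ?thesis
      by (cases "A' |\<inter>| B' = {||}") (simp_all add: monomial_times dh_mono ksign_insert1[of "fset A'"] ksign_insert2[of "fset B'"] ksign_insert2[of "fset A'"] mult_ac
         ksign_swap fcard.rep_eq)
  qed
qed (intro linear_intros linear_par linear_dh)+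

lemma dc_mult: "dc i (x * y) = dc i x * y + x * dc i y"
proof (rule bilinear_eq_mono[of "\<lambda>x y. dc i (x * y)" "\<lambda>x y. dc i x * y + x * dc i y"])
  fix A B :: "nat fset" and M N :: "nat multiset"
  have *: "real (count (M + N) i) *\<^sub>R monomial (C, M + N - {#i#}) =
      real (count M i) *\<^sub>R monomial (C, M - {#i#} + N) + real (count N i) *\<^sub>R monomial (C, M + (N - {#i#}))" for C
  proof (cases "i \<in># M")
    case True
    then obtain M' where [simp]: "M = add_mset i M'" by (metis multi_member_split)
    show ?thesis
    proof (cases "i \<in># N")
      case True
      then obtain N' where [simp]: "N = add_mset i N'" by (metis multi_member_split)
      show ?thesis by (simp flip: scaleR_left_distrib)
    qed (simp add: not_in_iff)
  next
    case False
    show ?thesis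
    proof (cases "i \<in># N")
      case True
      then obtain N' where [simp]: "N = add_mset i N'" by (metis multi_member_split)
      show ?thesis using False by (simp add: not_in_iff)
    qed (use False in \<open>simp add: not_in_iff\<close>)
  qed
  show "dc i (monomial (A, M) * monomial (B, N)) =
     dc i (monomial (A, M)) * monomial (B, N) + monomial (A, M) * dc i (monomial (B, N))"
    by (cases "A |\<inter>| B = {||}")
      (simp_all only: monomial_times dc_mono mmul.simps simp_thms if_True if_False lin_simps mult_scaleR_left
         mult_scaleR_right * scaleR_right_distrib scaleR_left_commute scaleR_zero_right add_0_left)
qed (intro linear_intros linear_par linear_dc)+

lemma der_mono:
  assumes "finite I" "fset A \<union> set_mset M \<subseteq> I"
  shows "der f g (monomial (A, M)) =
    (\<Sum>i\<in>I. f i * dh i (monomial (A, M)) + g i * dc i (monomial (A, M)))"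
proof -
  have "(\<Sum>i\<in>fset A. f i * dh i (monomial (A, M))) = (\<Sum>i\<in>I. f i * dh i (monomial (A, M)))"
    by (rule sum.mono_neutral_left) (use assms in \<open>auto simp: dh_mono\<close>)
  moreover have "(\<Sum>i\<in>set_mset M. g i * dc i (monomial (A, M))) = (\<Sum>i\<in>I. g i * dc i (monomial (A, M)))"
    by (rule sum.mono_neutral_left) (use assms in \<open>auto simp: dc_mono not_in_iff\<close>)
  ultimately show ?thesis by (simp add: der_def sum.distrib)
qed

lemma der_mult:
  assumes t: "linear t" and f: "\<And>i x. f i * par x = t x * f i" and g: "\<And>i x. g i * x = t x * g i"
  shows "der f g (x * y) = der f g x * y + t x * der f g y"
proof (rule bilinear_eq_mono[of "\<lambda>x y. der f g (x * y)" "\<lambda>x y. der f g x * y + t x * der f g y"])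
  fix A B :: "nat fset" and M N :: "nat multiset"
  let ?x = "monomial (A, M)" and ?y = "monomial (B, N)"
  let ?I = "fset A \<union> set_mset M \<union> fset B \<union> set_mset N"
  let ?D = "\<lambda>x. \<Sum>i\<in>?I. f i * dh i x + g i * dc i x"
  have "der f g (?x * ?y) = ?D (?x * ?y)"
  proof (cases "A |\<inter>| B = {||}")
    case True
    then have "?x * ?y = ksign (fset A) (fset B) *\<^sub>R monomial (A |\<union>| B, M + N)"
      by (simp add: monomial_times)
    moreover have "der f g (monomial (A |\<union>| B, M + N)) = ?D (monomial (A |\<union>| B, M + N))"
      by (rule der_mono) auto
    ultimately show ?thesis
      by (simp add: scaleR_right_distrib scaleR_sum_right)
  qed (simp add: monomial_times)
  also have "\<dots> = (\<Sum>i\<in>?I. (f i * dh i ?x + g i * dc i ?x) * ?y + t ?x * (f i * dh i ?y + g i * dc i ?y))"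
  proof (rule sum.cong[OF refl])
    fix i
    have "f i * (par ?x * dh i ?y) = t ?x * (f i * dh i ?y)"
      "g i * (?x * dc i ?y) = t ?x * (g i * dc i ?y)"
      using f[of i ?x] g[of i ?x] by (metis mult.assoc)+
    then show "f i * dh i (?x * ?y) + g i * dc i (?x * ?y) =
       (f i * dh i ?x + g i * dc i ?x) * ?y + t ?x * (f i * dh i ?y + g i * dc i ?y)"
      unfolding dh_mult dc_mult distrib_left distrib_right mult.assoc by simp
  qed
  also have "\<dots> = ?D ?x * ?y + t ?x * ?D ?y"
    by (simp only: sum.distrib[of "\<lambda>i. (f i * dh i ?x + g i * dc i ?x) * ?y"] sum_distrib_left sum_distrib_right)
  also have "?D ?x = der f g ?x" by (rule der_mono[symmetric]) auto
  also have "?D ?y = der f g ?y" by (rule der_mono[symmetric]) auto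
  finally show "der f g (?x * ?y) = der f g ?x * ?y + t ?x * der f g ?y" .
qed (intro linear_intros t linear_der)+

lemma der_h [simp]: "der f g (h i) = f i"
  by (simp add: h_def der_def dh_mono flip: one_dwt_def)

lemma der_c [simp]: "der f g (c i) = g i"
  by (simp add: c_def der_def dc_mono flip: one_dwt_def)

text \<open>The truncated subtraction in \<open>sigmat\<close> is harmless: its coefficient vanishes for \<open>i = 0\<close>.\<close>

definition dt :: "dwt \<Rightarrow> dwt" where
  "dt = der c (\<lambda>_. 0)"

definition deltat :: "dwt \<Rightarrow> dwt" where
  "deltat = der (\<lambda>i. h (i + 1)) (\<lambda>i. c (i + 1))"

definition sigmat :: "dwt \<Rightarrow> dwt" where
  "sigmat = der (\<lambda>i. (real i * (real i - 1) / 2) *\<^sub>R h (i - 1))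
                (\<lambda>i. (real i * (real i - 1) / 2) *\<^sub>R c (i - 1))"

lemma dt_mult: "dt (x * y) = dt x * y + par x * dt y"
  unfolding dt_def by (rule der_mult) (auto intro: linear_par c_commute)

lemma deltat_mult: "deltat (x * y) = deltat x * y + x * deltat y"
  unfolding deltat_def by (rule der_mult) (auto intro: linear_ident c_commute simp: h_commute)

lemma sigmat_mult: "sigmat (x * y) = sigmat x * y + x * sigmat y"
  unfolding sigmat_def by (rule der_mult) (auto intro: linear_ident c_commute simp: h_commute c_commute)


lemma dwt_gen_induct [case_names one add scale h c]:
  assumes one: "P 1" and add: "\<And>x y. P x \<Longrightarrow> P y \<Longrightarrow> P (x + y)"
    and scale: "\<And>r x. P x \<Longrightarrow> P (r *\<^sub>R x)"
    and h: "\<And>i x. P x \<Longrightarrow> P (h i * x)" and c: "\<And>i x. P x \<Longrightarrow> P (c i * x)"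
  shows "P x"
proof -
  have M: "P (monomial ({||}, M))" for M
  proof (induction M)
    case empty
    show ?case using one by (simp add: one_dwt_def)
  next
    case (add i M)
    then have "P (c i * monomial ({||}, M))" by (rule c)
    then show ?case by (simp add: c_def monomial_times)
  qed
  have AM: "P (monomial (A, M))" for A M
  proof (induction A)
    case (insert a A)
    then have "P (ksign {a} (fset A) *\<^sub>R (h a * monomial (A, M)))" by (intro scale h)
    moreover have "h a * monomial (A, M) = ksign {a} (fset A) *\<^sub>R monomial (finsert a A, M)"
      using insert by (simp add: h_def monomial_times)
    ultimately show ?case by simp
  qed (rule M)
  have "P 0" using scale[of 1 0] one by simp
  then have "P (\<Sum>m\<in>S. coeff x m *\<^sub>R monomial m)" for S
    by (induction S rule: infinite_finite_induct) (auto intro!: add scale AM simp: split_paired_all)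
  then show ?thesis by (subst dwt_expand)
qed

lemma par_h [simp]: "par (h i) = - h i" and par_c [simp]: "par (c i) = c i"
  and par_1 [simp]: "par 1 = 1"
  by (simp_all add: h_def c_def one_dwt_def fcard.rep_eq)

lemma dt_h [simp]: "dt (h i) = c i" and dt_c [simp]: "dt (c i) = 0"
  and deltat_h [simp]: "deltat (h i) = h (i + 1)" and deltat_c [simp]: "deltat (c i) = c (i + 1)"
  and sigmat_h [simp]: "sigmat (h i) = (real i * (real i - 1) / 2) *\<^sub>R h (i - 1)"
  and sigmat_c [simp]: "sigmat (c i) = (real i * (real i - 1) / 2) *\<^sub>R c (i - 1)"
  by (simp_all add: dt_def deltat_def sigmat_def)

lemma linear_dt: "linear dt" and linear_deltat: "linear deltat" and linear_sigmat: "linear sigmat"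
  by (simp_all add: dt_def deltat_def sigmat_def linear_der)

lemmas lin_simps2 [simp] =
  linear_add[OF linear_dt] linear_scale[OF linear_dt] linear_0[OF linear_dt] linear_diff[OF linear_dt] linear_neg[OF linear_dt]
  linear_add[OF linear_deltat] linear_scale[OF linear_deltat] linear_0[OF linear_deltat] linear_diff[OF linear_deltat] linear_neg[OF linear_deltat]
  linear_add[OF linear_sigmat] linear_scale[OF linear_sigmat] linear_0[OF linear_sigmat] linear_diff[OF linear_sigmat] linear_neg[OF linear_sigmat]

lemma der_1 [simp]: "der f g 1 = 0"
  by (simp add: der_def one_dwt_def)

lemma dt_1 [simp]: "dt 1 = 0" and deltat_1 [simp]: "deltat 1 = 0" and sigmat_1 [simp]: "sigmat 1 = 0"
  by (simp_all add: dt_def deltat_def sigmat_def)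

lemma dt_dt [simp]: "dt (dt x) = 0"
  by (induction x rule: dwt_gen_induct) (simp_all add: dt_mult)

lemma dt_par: "dt (par x) = - par (dt x)"
  by (induction x rule: dwt_gen_induct) (simp_all add: dt_mult par_mult algebra_simps)

lemma deltat_par: "deltat (par x) = par (deltat x)"
  by (induction x rule: dwt_gen_induct) (simp_all add: deltat_mult par_mult algebra_simps)

lemma dt_deltat: "dt (deltat x) = deltat (dt x)"
  by (induction x rule: dwt_gen_induct) (simp_all add: dt_mult deltat_mult algebra_simps)

lemma dt_sigmat: "dt (sigmat x) = sigmat (dt x)"
  by (induction x rule: dwt_gen_induct) (simp_all add: dt_mult sigmat_mult algebra_simps)

text \<open>Multiplication of a monomial by its order; it is the commutator of \<open>sigmat\<close> and \<open>deltat\<close>.\<close>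

definition eulert :: "dwt \<Rightarrow> dwt" where
  "eulert = der (\<lambda>i. real i *\<^sub>R h i) (\<lambda>i. real i *\<^sub>R c i)"

lemma eulert_mult: "eulert (x * y) = eulert x * y + x * eulert y"
  unfolding eulert_def by (rule der_mult) (auto intro: linear_ident c_commute simp: h_commute c_commute)

lemma eulert_simps [simp]: "eulert (h i) = real i *\<^sub>R h i" "eulert (c i) = real i *\<^sub>R c i"
  "eulert 1 = 0" "eulert 0 = 0" "eulert (x + y) = eulert x + eulert y" "eulert (r *\<^sub>R x) = r *\<^sub>R eulert x"
  by (simp_all add: eulert_def)

lemma sigmat_deltat: "sigmat (deltat x) = deltat (sigmat x) + eulert x"
proof (induction x rule: dwt_gen_induct)
  case (h i x)
  have "real (i + 1) * (real (i + 1) - 1) / 2 = real i * (real i - 1) / 2 + real i"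
    by (simp add: field_simps)
  moreover have "(real i * (real i - 1) / 2) *\<^sub>R h i = (real i * (real i - 1) / 2) *\<^sub>R h (i - 1 + 1)"
    by (cases i) simp_all
  ultimately have "(real (i + 1) * (real (i + 1) - 1) / 2) *\<^sub>R h i =
        (real i * (real i - 1) / 2) *\<^sub>R h (i - 1 + 1) + real i *\<^sub>R h i"
    by (simp only: scaleR_left_distrib)
  then have *: "sigmat (h (i + 1)) = deltat (sigmat (h i)) + eulert (h i)"
    by simp
  show ?case using h
    by (simp add: sigmat_mult deltat_mult eulert_mult *[folded Suc_eq_plus1] algebra_simps
        del: sigmat_h eulert_simps(1,2) linear_scale[OF linear_sigmat])
next
  case (c i x)
  have "real (i + 1) * (real (i + 1) - 1) / 2 = real i * (real i - 1) / 2 + real i"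
    by (simp add: field_simps)
  moreover have "(real i * (real i - 1) / 2) *\<^sub>R c i = (real i * (real i - 1) / 2) *\<^sub>R c (i - 1 + 1)"
    by (cases i) simp_all
  ultimately have "(real (i + 1) * (real (i + 1) - 1) / 2) *\<^sub>R c i =
        (real i * (real i - 1) / 2) *\<^sub>R c (i - 1 + 1) + real i *\<^sub>R c i"
    by (simp only: scaleR_left_distrib)
  then have *: "sigmat (c (i + 1)) = deltat (sigmat (c i)) + eulert (c i)"
    by simp
  show ?case using c
    by (simp add: sigmat_mult deltat_mult eulert_mult *[folded Suc_eq_plus1] algebra_simps
        del: sigmat_c eulert_simps(1,2) linear_scale[OF linear_sigmat])
qed (simp_all add: algebra_simps)

lemma eulert_deltat: "eulert (deltat x) = deltat (eulert x) + deltat x"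
  by (induction x rule: dwt_gen_induct) (simp_all add: deltat_mult eulert_mult algebra_simps)

definition ideal_gen :: "'a::real_algebra set \<Rightarrow> 'a set" where
  "ideal_gen S = span {x * s * y | x s y. s \<in> S}"

definition dwI :: "dwt set" where
  "dwI = ideal_gen (range (\<lambda>k. (deltat ^^ k) ((c 0)\<^sup>2)))"

lemma ideal_gen_subspace: "subspace (ideal_gen S)"
  by (simp add: ideal_gen_def)

lemma ideal_gen_image:
  assumes "linear f" "\<And>x s y. s \<in> S \<Longrightarrow> f (x * s * y) \<in> ideal_gen S" "z \<in> ideal_gen S"
  shows "f z \<in> ideal_gen S"
proof -
  have "f ` span {x * s * y | x s y. s \<in> S} = span (f ` {x * s * y | x s y. s \<in> S})"
    by (rule linear_span_image[OF assms(1), symmetric])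
  also have "\<dots> \<subseteq> ideal_gen S"
    by (rule span_minimal) (use assms(2) ideal_gen_subspace in auto)
  finally show ?thesis using assms(3) by (auto simp: ideal_gen_def)
qed

lemma ideal_gen_gen: "s \<in> S \<Longrightarrow> x * s * y \<in> ideal_gen S"
  unfolding ideal_gen_def by (rule span_base) auto

lemma dwI_gen: "x * (deltat ^^ k) ((c 0)\<^sup>2) * y \<in> dwI"
  unfolding dwI_def by (rule ideal_gen_gen) auto

lemma dwI_subspace: "subspace dwI"
  by (simp add: dwI_def ideal_gen_subspace)

lemmas dwI_0 [simp] = subspace_0[OF dwI_subspace]
  and dwI_add = subspace_add[OF dwI_subspace]
  and dwI_diff = subspace_diff[OF dwI_subspace]
  and dwI_scale = subspace_scale[OF dwI_subspace]
  and dwI_neg = subspace_neg[OF dwI_subspace]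

lemma dwI_image:
  assumes "linear f" "\<And>x k y. f (x * (deltat ^^ k) ((c 0)\<^sup>2) * y) \<in> dwI" "z \<in> dwI"
  shows "f z \<in> dwI"
  using ideal_gen_image[OF assms(1), of "range (\<lambda>k. (deltat ^^ k) ((c 0)\<^sup>2))" z] assms(2,3)
  by (auto simp: dwI_def)

lemma dwI_timesL: "z \<in> dwI \<Longrightarrow> w * z \<in> dwI"
  by (rule dwI_image[of "\<lambda>z. w * z"]) (auto intro: times_linear2 dwI_gen simp flip: mult.assoc)

lemma dwI_timesR: "z \<in> dwI \<Longrightarrow> z * w \<in> dwI"
  by (rule dwI_image[of "\<lambda>z. z * w"]) (auto intro: times_linear1 dwI_gen simp: mult.assoc[of _ _ w])

lemma par_gen: "par ((deltat ^^ k) ((c 0)\<^sup>2)) = (deltat ^^ k) ((c 0)\<^sup>2)"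
  by (induction k) (simp_all add: power2_eq_square par_mult flip: deltat_par)

lemma dt_gen: "dt ((deltat ^^ k) ((c 0)\<^sup>2)) = 0"
  by (induction k) (simp_all add: power2_eq_square dt_mult dt_deltat)

lemma eulert_gen: "eulert ((deltat ^^ k) ((c 0)\<^sup>2)) = real k *\<^sub>R (deltat ^^ k) ((c 0)\<^sup>2)"
  by (induction k) (simp_all add: power2_eq_square eulert_mult eulert_deltat algebra_simps)

lemma sigmat_gen: "sigmat ((deltat ^^ k) ((c 0)\<^sup>2)) =
    (real k * (real k - 1) / 2) *\<^sub>R (deltat ^^ (k - 1)) ((c 0)\<^sup>2)"
proof (induction k)
  case (Suc k)
  then have "sigmat ((deltat ^^ Suc k) ((c 0)\<^sup>2)) =
     (real k * (real k - 1) / 2) *\<^sub>R (deltat ^^ (Suc (k - 1))) ((c 0)\<^sup>2) + real k *\<^sub>R (deltat ^^ k) ((c 0)\<^sup>2)"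
    by (simp add: sigmat_deltat eulert_gen)
  also have "\<dots> = (real k * (real k - 1) / 2 + real k) *\<^sub>R (deltat ^^ k) ((c 0)\<^sup>2)"
    by (cases k) (simp_all add: scaleR_left_distrib)
  also have "real k * (real k - 1) / 2 + real k = real (Suc k) * (real (Suc k) - 1) / 2"
    by (simp add: field_simps)
  finally show ?case by simp
qed (simp add: power2_eq_square sigmat_mult)

lemma dwI_par: "z \<in> dwI \<Longrightarrow> par z \<in> dwI"
  by (rule dwI_image[OF linear_par]) (auto simp: par_mult par_gen dwI_gen)

lemma dwI_dt: "z \<in> dwI \<Longrightarrow> dt z \<in> dwI"
  by (rule dwI_image[OF linear_dt]) (auto simp: dt_mult dt_gen par_mult par_gen intro!: dwI_gen dwI_add)

lemma dwI_deltat: "z \<in> dwI \<Longrightarrow> deltat z \<in> dwI"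
proof (rule dwI_image[OF linear_deltat])
  fix x y k
  show "deltat (x * (deltat ^^ k) ((c 0)\<^sup>2) * y) \<in> dwI"
    using dwI_gen[of x "Suc k" y]
    by (auto simp: deltat_mult distrib_right intro!: dwI_gen dwI_add)
qed

lemma dwI_sigmat: "z \<in> dwI \<Longrightarrow> sigmat z \<in> dwI"
  by (rule dwI_image[OF linear_sigmat])
    (auto simp: sigmat_mult distrib_right sigmat_gen intro!: dwI_gen dwI_add dwI_scale)

quotient_type dw = dwt / "\<lambda>x y. x - y \<in> dwI"
  morphisms rep_dw proj
proof (rule equivpI)
  show "symp (\<lambda>x y. x - y \<in> dwI)"
    by (rule sympI) (metis dwI_neg minus_diff_eq)
  show "transp (\<lambda>x y. x - y \<in> dwI)"
    by (rule transpI) (metis dwI_add diff_add_cancel add_diff_eq)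
qed (simp add: reflp_def)

lemma proj_eq_iff: "proj x = proj y \<longleftrightarrow> x - y \<in> dwI"
  by (rule dw.abs_eq_iff)

instantiation dw :: real_algebra
begin

lift_definition zero_dw :: dw is 0 .
lift_definition plus_dw :: "dw \<Rightarrow> dw \<Rightarrow> dw" is "(+)"
  by (metis dwI_add add_diff_add)
lift_definition uminus_dw :: "dw \<Rightarrow> dw" is uminus
  by (metis dwI_neg minus_diff_minus)
lift_definition minus_dw :: "dw \<Rightarrow> dw \<Rightarrow> dw" is "(-)"
  by (metis dwI_diff diff_diff_eq2 diff_diff_add add_diff_eq diff_add_eq add.commute)
lift_definition scaleR_dw :: "real \<Rightarrow> dw \<Rightarrow> dw" is "(*\<^sub>R)"
  by (metis dwI_scale scaleR_right_diff_distrib)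
lift_definition times_dw :: "dw \<Rightarrow> dw \<Rightarrow> dw" is "(*)"
proof -
  fix x x' y y' :: dwt
  assume "x - x' \<in> dwI" "y - y' \<in> dwI"
  then have "(x - x') * y + x' * (y - y') \<in> dwI"
    by (intro dwI_add dwI_timesL dwI_timesR)
  then show "x * y - x' * y' \<in> dwI" by (simp add: algebra_simps)
qed

instance
  by standard (transfer; simp add: algebra_simps)+

end

lift_definition d :: "dw \<Rightarrow> dw" is dt by (metis dwI_dt lin_simps2(4))
lift_definition parq :: "dw \<Rightarrow> dw" is par by (metis dwI_par linear_diff[OF linear_par])
lift_definition deltaq :: "dw \<Rightarrow> dw" is deltat by (metis dwI_deltat linear_diff[OF linear_deltat])
lift_definition sigmaq :: "dw \<Rightarrow> dw" is sigmat by (metis dwI_sigmat linear_diff[OF linear_sigmat])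

lemma proj_simps:
  "proj 0 = 0" "proj (x + y) = proj x + proj y" "proj (x - y) = proj x - proj y"
  "proj (- x) = - proj x" "proj (r *\<^sub>R x) = r *\<^sub>R proj x" "proj (x * y) = proj x * proj y"
  "proj (dt x) = d (proj x)" "proj (par x) = parq (proj x)"
  "proj (deltat x) = deltaq (proj x)" "proj (sigmat x) = sigmaq (proj x)"
  by (simp_all add: zero_dw_def plus_dw.abs_eq minus_dw.abs_eq uminus_dw.abs_eq scaleR_dw.abs_eq
      times_dw.abs_eq d.abs_eq parq.abs_eq deltaq.abs_eq sigmaq.abs_eq)

lemma linear_d: "linear d" and linear_deltaq: "linear deltaq" and linear_sigmaq: "linear sigmaq"
  by (rule linearI; transfer; simp)+

lemmas lin_simps3 [simp] =
  linear_add[OF linear_d] linear_scale[OF linear_d] linear_0[OF linear_d] linear_diff[OF linear_d] linear_neg[OF linear_d]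
  linear_add[OF linear_deltaq] linear_scale[OF linear_deltaq] linear_0[OF linear_deltaq] linear_diff[OF linear_deltaq] linear_neg[OF linear_deltaq]
  linear_add[OF linear_sigmaq] linear_scale[OF linear_sigmaq] linear_0[OF linear_sigmaq] linear_diff[OF linear_sigmaq] linear_neg[OF linear_sigmaq]

lemma parq_0 [simp]: "parq 0 = 0"
  by transfer simp

lemma d_d [simp]: "d (d x) = 0"
  by transfer simp

lemma d_mult: "d (x * y) = d x * y + parq x * d y"
  by transfer (simp add: dt_mult)

lemma deltaq_mult: "deltaq (x * y) = deltaq x * y + x * deltaq y"
  by transfer (simp add: deltat_mult)

lemma sigmaq_mult: "sigmaq (x * y) = sigmaq x * y + x * sigmaq y"
  by transfer (simp add: sigmat_mult)

lemma d_parq: "d (parq x) = - parq (d x)"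
  by transfer (simp add: dt_par)

lemma parq_parq [simp]: "parq (parq x) = x"
  by transfer simp

lemma d_deltaq: "d (deltaq x) = deltaq (d x)"
  by transfer (simp add: dt_deltat)

lemma d_sigmaq: "d (sigmaq x) = sigmaq (d x)"
  by transfer (simp add: dt_sigmat)

text \<open>
  Cohomology. The relation is partial: its domain consists of the cocycles, so \<open>cls x\<close> is
  meaningful only when \<open>d x = 0\<close>.
\<close>

quotient_type hdw = dw / partial: "\<lambda>x y. d x = 0 \<and> d y = 0 \<and> (\<exists>z. x - y = d z)"
  morphisms rep_hdw cls
proof (rule part_equivpI)
  show "\<exists>x. d x = 0 \<and> d x = 0 \<and> (\<exists>z. x - x = d z)"
    by (rule exI[of _ 0]) (auto intro: exI[of _ 0])
  show "symp (\<lambda>x y. d x = 0 \<and> d y = 0 \<and> (\<exists>z. x - y = d z))"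
    by (rule sympI) (metis minus_diff_eq linear_neg[OF linear_d])
  show "transp (\<lambda>x y. d x = 0 \<and> d y = 0 \<and> (\<exists>z. x - y = d z))"
    by (rule transpI) (metis linear_add[OF linear_d] diff_add_cancel add_diff_eq)
qed

lemma cohomologous_refl: "d x = 0 \<Longrightarrow> d x = 0 \<and> d x = 0 \<and> (\<exists>z. x - x = d z)"
  by (auto intro: exI[of _ 0])

instantiation hdw :: real_algebra
begin

lift_definition zero_hdw :: hdw is 0 by (rule cohomologous_refl) simp
lift_definition plus_hdw :: "hdw \<Rightarrow> hdw \<Rightarrow> hdw" is "(+)"
proof -
  fix x x' y y' :: dw
  assume "d x = 0 \<and> d x' = 0 \<and> (\<exists>z. x - x' = d z)" "d y = 0 \<and> d y' = 0 \<and> (\<exists>z. y - y' = d z)"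
  then obtain z w where c: "d x = 0" "d x' = 0" "d y = 0" "d y' = 0" and zw: "x - x' = d z" "y - y' = d w"
    by blast
  have "(x + y) - (x' + y') = (x - x') + (y - y')"
    by (simp add: algebra_simps)
  also have "\<dots> = d (z + w)"
    by (simp add: zw c d_mult d_parq)
  finally have "\<exists>z. (x + y) - (x' + y') = d z" by (rule exI)
  moreover have "d (x + y) = 0" "d (x' + y') = 0" by (simp_all add: c d_mult)
  ultimately show "d (x + y) = 0 \<and> d (x' + y') = 0 \<and> (\<exists>z. (x + y) - (x' + y') = d z)"
    by (intro conjI)
qed
lift_definition uminus_hdw :: "hdw \<Rightarrow> hdw" is "uminus"
proof -
  fix x x' :: dw and r :: real
  assume "d x = 0 \<and> d x' = 0 \<and> (\<exists>z. x - x' = d z)"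
  then obtain z where c: "d x = 0" "d x' = 0" and z: "x - x' = d z" by blast
  have "- x - - x' = - (x - x')"
    by (simp add: algebra_simps)
  also have "\<dots> = d (- z)"
    by (simp add: z)
  finally have "\<exists>z. - x - - x' = d z" by (rule exI)
  moreover have "d (- x) = 0" "d (- x') = 0" by (simp_all add: c)
  ultimately show "d (- x) = 0 \<and> d (- x') = 0 \<and> (\<exists>z. - x - - x' = d z)"
    by (intro conjI)
qed
lift_definition minus_hdw :: "hdw \<Rightarrow> hdw \<Rightarrow> hdw" is "(-)"
proof -
  fix x x' y y' :: dw
  assume "d x = 0 \<and> d x' = 0 \<and> (\<exists>z. x - x' = d z)" "d y = 0 \<and> d y' = 0 \<and> (\<exists>z. y - y' = d z)"
  then obtain z w where c: "d x = 0" "d x' = 0" "d y = 0" "d y' = 0" and zw: "x - x' = d z" "y - y' = d w"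
    by blast
  have "(x - y) - (x' - y') = (x - x') - (y - y')"
    by (simp add: algebra_simps)
  also have "\<dots> = d (z - w)"
    by (simp add: zw c d_mult d_parq)
  finally have "\<exists>z. (x - y) - (x' - y') = d z" by (rule exI)
  moreover have "d (x - y) = 0" "d (x' - y') = 0" by (simp_all add: c d_mult)
  ultimately show "d (x - y) = 0 \<and> d (x' - y') = 0 \<and> (\<exists>z. (x - y) - (x' - y') = d z)"
    by (intro conjI)
qed
lift_definition scaleR_hdw :: "real \<Rightarrow> hdw \<Rightarrow> hdw" is "(*\<^sub>R)"
proof -
  fix x x' :: dw and r :: real
  assume "d x = 0 \<and> d x' = 0 \<and> (\<exists>z. x - x' = d z)"
  then obtain z where c: "d x = 0" "d x' = 0" and z: "x - x' = d z" by blast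
  have "r *\<^sub>R x - r *\<^sub>R x' = r *\<^sub>R (x - x')"
    by (simp add: algebra_simps)
  also have "\<dots> = d (r *\<^sub>R z)"
    by (simp add: z)
  finally have "\<exists>z. r *\<^sub>R x - r *\<^sub>R x' = d z" by (rule exI)
  moreover have "d (r *\<^sub>R x) = 0" "d (r *\<^sub>R x') = 0" by (simp_all add: c)
  ultimately show "d (r *\<^sub>R x) = 0 \<and> d (r *\<^sub>R x') = 0 \<and> (\<exists>z. r *\<^sub>R x - r *\<^sub>R x' = d z)"
    by (intro conjI)
qed
lift_definition times_hdw :: "hdw \<Rightarrow> hdw \<Rightarrow> hdw" is "(*)"
proof -
  fix x x' y y' :: dw
  assume "d x = 0 \<and> d x' = 0 \<and> (\<exists>z. x - x' = d z)" "d y = 0 \<and> d y' = 0 \<and> (\<exists>z. y - y' = d z)"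
  then obtain z w where c: "d x = 0" "d x' = 0" "d y = 0" "d y' = 0" and zw: "x - x' = d z" "y - y' = d w"
    by blast
  have "(x * y) - (x' * y') = (x - x') * y + x' * (y - y')"
    by (simp add: algebra_simps)
  also have "\<dots> = d (z * y + parq x' * w)"
    by (simp add: zw c d_mult d_parq)
  finally have "\<exists>z. (x * y) - (x' * y') = d z" by (rule exI)
  moreover have "d (x * y) = 0" "d (x' * y') = 0" by (simp_all add: c d_mult)
  ultimately show "d (x * y) = 0 \<and> d (x' * y') = 0 \<and> (\<exists>z. (x * y) - (x' * y') = d z)"
    by (intro conjI)
qed

lemma hdw_cases:
  obtains x where "d x = 0" "X = cls x"
proof -
  have "d (rep_hdw X) = 0" "X = cls (rep_hdw X)"
    using Quotient_rep_reflp[OF Quotient_hdw, of X] Quotient_abs_rep[OF Quotient_hdw, of X] by auto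
  then show thesis by (rule that)
qed

lemma cls_simps:
  "cls 0 = 0"
  "d x = 0 \<Longrightarrow> d y = 0 \<Longrightarrow> cls x + cls y = cls (x + y)"
  "d x = 0 \<Longrightarrow> d y = 0 \<Longrightarrow> cls x - cls y = cls (x - y)"
  "d x = 0 \<Longrightarrow> - cls x = cls (- x)"
  "d x = 0 \<Longrightarrow> r *\<^sub>R cls x = cls (r *\<^sub>R x)"
  "d x = 0 \<Longrightarrow> d y = 0 \<Longrightarrow> cls x * cls y = cls (x * y)"
proof -
  show "cls 0 = 0" by (simp only: zero_hdw_def)
qed (rule plus_hdw.abs_eq minus_hdw.abs_eq uminus_hdw.abs_eq
      scaleR_hdw.abs_eq times_hdw.abs_eq; rule cohomologous_refl; assumption)+

instance
proof
  fix X Y Z :: hdw and r s :: real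
  obtain x where [simp]: "d x = 0" "X = cls x" by (rule hdw_cases)
  obtain y where [simp]: "d y = 0" "Y = cls y" by (rule hdw_cases)
  obtain z where [simp]: "d z = 0" "Z = cls z" by (rule hdw_cases)
  show "X + Y + Z = X + (Y + Z)" "X + Y = Y + X" "0 + X = X" "- X + X = 0" "X - Y = X + - Y"
    "r *\<^sub>R (X + Y) = r *\<^sub>R X + r *\<^sub>R Y" "(r + s) *\<^sub>R X = r *\<^sub>R X + s *\<^sub>R X"
    "r *\<^sub>R s *\<^sub>R X = (r * s) *\<^sub>R X" "1 *\<^sub>R X = X"
    "X * Y * Z = X * (Y * Z)" "(X + Y) * Z = X * Z + Y * Z" "X * (Y + Z) = X * Y + X * Z"
    "r *\<^sub>R X * Y = r *\<^sub>R (X * Y)" "X * r *\<^sub>R Y = r *\<^sub>R (X * Y)"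
    by (simp_all add: cls_simps(1)[symmetric] cls_simps(2-) d_mult algebra_simps)
qed

end

lemma cls_eq_iff: "d x = 0 \<Longrightarrow> d y = 0 \<Longrightarrow> cls x = cls y \<longleftrightarrow> (\<exists>z. x - y = d z)"
  using Quotient_rel[OF Quotient_hdw, of x y] cohomologous_refl[of x] cohomologous_refl[of y] by blast

lift_definition delta :: "hdw \<Rightarrow> hdw" is deltaq
  by (auto simp: d_deltaq simp flip: linear_diff[OF linear_deltaq]) (metis d_deltaq)

lift_definition sigma :: "hdw \<Rightarrow> hdw" is sigmaq
  by (auto simp: d_sigmaq simp flip: linear_diff[OF linear_sigmaq]) (metis d_sigmaq)

lemma delta_cls: "d x = 0 \<Longrightarrow> delta (cls x) = cls (deltaq x)"
  and sigma_cls: "d x = 0 \<Longrightarrow> sigma (cls x) = cls (sigmaq x)"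
  by (auto intro!: delta.abs_eq sigma.abs_eq cohomologous_refl)

lemma delta_mult: "delta (X * Y) = delta X * Y + X * delta Y"
  and sigma_mult: "sigma (X * Y) = sigma X * Y + X * sigma Y"
  by (cases X rule: hdw_cases; cases Y rule: hdw_cases;
      simp add: cls_simps delta_cls sigma_cls d_mult d_deltaq d_sigmaq deltaq_mult sigmaq_mult)+

definition monom_ord :: "monom \<Rightarrow> nat" where
  "monom_ord = (\<lambda>(A, M). \<Sum>(fset A) + sum_mset M)"

definition monom_deg :: "monom \<Rightarrow> nat" where
  "monom_deg = (\<lambda>(A, M). fcard A + 2 * size M)"

definition hdw_ord :: "nat \<Rightarrow> hdw set" where
  "hdw_ord n = {cls (proj x) | x. d (proj x) = 0 \<and> (\<forall>m. coeff x m \<noteq> 0 \<longrightarrow> monom_ord m = n)}"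

definition hdw_deg :: "nat \<Rightarrow> hdw set" where
  "hdw_deg n = {cls (proj x) | x. d (proj x) = 0 \<and> (\<forall>m. coeff x m \<noteq> 0 \<longrightarrow> monom_deg m = n)}"

definition GV :: hdw where
  "GV = cls (proj (h 0 * c 0))"

lemma GV_cocycle: "d (proj (h 0 * c 0)) = 0"
proof -
  have "dt (h 0 * c 0) \<in> dwI"
    using dwI_gen[of 1 0 1] by (simp add: dt_mult power2_eq_square)
  then show ?thesis by (simp add: proj_eq_iff flip: proj_simps)
qed

lemma h1h2c0c2_cocycle: "d (proj (h 1 * h 2 * c 0 * c 2)) = 0"
proof -
  have cc: "c i * c j = c j * c i" "c i * (c j * x) = c j * (c i * x)"
    "c i * (h j * x) = h j * (c i * x)" for i j x
    by (simp_all add: c_commute[of i] mult.assoc)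
  let ?s = "\<lambda>k. (deltat ^^ k) ((c 0)\<^sup>2)"
  have s1: "?s 1 = 2 *\<^sub>R (c 0 * c 1)"
    by (simp add: power2_eq_square deltat_mult cc scaleR_2)
  have s2: "?s 2 = 2 *\<^sub>R (c 1 * c 1) + 2 *\<^sub>R (c 0 * c 2)"
    using s1 by (simp add: eval_nat_numeral deltat_mult cc scaleR_2 algebra_simps)
  have s3: "?s 3 = 6 *\<^sub>R (c 1 * c 2) + 2 *\<^sub>R (c 0 * c 3)"
  proof -
    have "?s 3 = deltat (?s 2)" by (simp add: eval_nat_numeral)
    also have "\<dots> = 4 *\<^sub>R (c 1 * c 2) + 2 *\<^sub>R (c 1 * c 2) + 2 *\<^sub>R (c 0 * c 3)"
      unfolding s2 by (simp add: deltat_mult cc scaleR_right_distrib flip: scaleR_2 numeral_2_eq_2 numeral_3_eq_3)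
    finally show ?thesis by (simp flip: scaleR_left_distrib)
  qed
  have "dt (h 1 * h 2 * c 0 * c 2) = h 2 * (c 0 * c 1) * c 2 - h 1 * (c 0 * c 2) * c 2"
    by (simp add: dt_mult par_mult cc algebra_simps mult.assoc)
  also have "\<dots> = (1/2) *\<^sub>R (h 2 * ?s 1 * c 2) - (1/2) *\<^sub>R (h 1 * ?s 2 * c 2)
      + (1/6) *\<^sub>R ((h 1 * c 1) * ?s 3 * 1) - (1/6) *\<^sub>R (h 1 * ?s 1 * c 3)"
    unfolding s1 s2 s3 by (simp add: algebra_simps cc mult.assoc)
  also have "\<dots> \<in> dwI" by (intro dwI_add dwI_diff dwI_scale dwI_gen)
  finally show ?thesis by (simp add: proj_eq_iff flip: proj_simps)
qed

lemma GV_deg: "GV \<in> hdw_deg 3"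
proof -
  have "coeff (h 0 * c 0) m \<noteq> 0 \<longrightarrow> monom_deg m = 3" for m
    by (simp add: h_def c_def monomial_times coeff_mono monom_deg_def fcard.rep_eq)
  then show ?thesis unfolding GV_def hdw_deg_def using GV_cocycle by blast
qed

definition eigenspace :: "('a::real_vector \<Rightarrow> 'a) \<Rightarrow> 'a set \<Rightarrow> real \<Rightarrow> 'a set" where
  "eigenspace T V \<mu> = {x \<in> V. T x = \<mu> *\<^sub>R x}"

definition F05 :: "hdw set" where
  "F05 = eigenspace (delta \<circ> sigma) (hdw_ord 5) 0"

end

theory Submission
  imports Defs
begin

text \<open>
  Write \<open>\<omega>\<close> for \<open>h\<^bsub>(1)\<^esub> h\<^bsub>(2)\<^esub> c\<^bsub>(0)\<^esub> c\<^bsub>(2)\<^esub>\<close>. Explicit primitives show that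
  \<open>\<delta>(GV) \<delta>\<^sup>4(GV)\<close> and \<open>\<delta>\<^sup>2(GV) \<delta>\<^sup>3(GV)\<close> are cohomologous to \<open>12 \<omega>\<close> and \<open>- 12 \<omega>\<close>. Modulo the
  ideal, \<open>\<sigma>\<close> kills \<open>\<omega>\<close>, since \<open>\<sigma> \<omega> = h\<^bsub>(1)\<^esub> h\<^bsub>(2)\<^esub> c\<^bsub>(0)\<^esub> c\<^bsub>(1)\<^esub>\<close> and
  \<open>2 c\<^bsub>(0)\<^esub> c\<^bsub>(1)\<^esub> = \<delta>(c\<^bsub>(0)\<^esub>\<^sup>2)\<close>. The class of \<open>\<omega>\<close> is non-zero because a linear
  functional that vanishes on the ideal and on all coboundaries takes the value 5 on \<open>\<omega>\<close>.
\<close>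

section \<open>Normal forms of products and the generators of the ideal\<close>

abbreviation gen :: "nat \<Rightarrow> dwt" where
  "gen k \<equiv> (deltat ^^ k) ((c 0)\<^sup>2)"

lemma c_h_normal:
  "c i * c j = c j * c i" "c i * (c j * x) = c j * (c i * x)"
  "c i * h j = h j * c i" "c i * (h j * x) = h j * (c i * x)"
  by (simp_all add: c_commute[of i] mult.assoc)

lemma h_anticommute: "h j * h i = - (h i * h j)"
  by (simp add: h_commute[of j])

lemma h_square [simp]: "h i * h i = 0"
  using h_anticommute[of i i] by (simp add: eq_neg_iff_add_eq_0 flip: scaleR_2)

lemma h_square_left [simp]: "h i * (h i * x) = 0"
  by (simp flip: mult.assoc)

text \<open>The hypothesis orients anticommutativity: rewriting sorts the odd factors and
  terminates. With \<open>c_h_normal\<close> it leads to sorted odd factors followed by sorted even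
  ones.\<close>

lemma h_normal:
  assumes "i < j"
  shows "h j * h i = - (h i * h j)" "h j * (h i * x) = - (h i * (h j * x))"
  by (simp_all add: h_anticommute[of j i] flip: mult.assoc)

lemma gen_expansion:
  "gen 0 = c 0 * c 0"
  "gen 1 = 2 *\<^sub>R (c 0 * c 1)"
  "gen 2 = 2 *\<^sub>R (c 0 * c 2) + 2 *\<^sub>R (c 1 * c 1)"
  "gen 3 = 2 *\<^sub>R (c 0 * c 3) + 6 *\<^sub>R (c 1 * c 2)"
  "gen 4 = 2 *\<^sub>R (c 0 * c 4) + 8 *\<^sub>R (c 1 * c 3) + 6 *\<^sub>R (c 2 * c 2)"
proof -
  have step: "gen (Suc k) = deltat (gen k)" for k by simp
  show 0: "gen 0 = c 0 * c 0" by (simp add: power2_eq_square)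
  show 1: "gen 1 = 2 *\<^sub>R (c 0 * c 1)"
    unfolding One_nat_def step 0 by (simp add: deltat_mult c_h_normal scaleR_2)
  show 2: "gen 2 = 2 *\<^sub>R (c 0 * c 2) + 2 *\<^sub>R (c 1 * c 1)"
    using step[of 1] unfolding 1
    by (simp add: deltat_mult c_h_normal scaleR_right_distrib flip: numeral_2_eq_2)
  have three: "Suc 2 = 3" and four: "Suc 3 = 4" by simp_all
  show 3: "gen 3 = 2 *\<^sub>R (c 0 * c 3) + 6 *\<^sub>R (c 1 * c 2)"
    using step[of 2] unfolding 2 three
    by (simp add: deltat_mult c_h_normal scaleR_right_distrib flip: numeral_2_eq_2 numeral_3_eq_3 scaleR_left_distrib)
  show "gen 4 = 2 *\<^sub>R (c 0 * c 4) + 8 *\<^sub>R (c 1 * c 3) + 6 *\<^sub>R (c 2 * c 2)"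
    using step[of 3] unfolding 3 four
    by (simp add: deltat_mult c_h_normal scaleR_right_distrib flip: numeral_2_eq_2 numeral_3_eq_3 scaleR_left_distrib)
qed

text \<open>For general \<open>k\<close> only this shape matters, quadratic in the even generators
  and of order \<open>k\<close>. It gives centrality and, for \<open>k\<close> outside 2 to 4, the
  vanishing of \<open>phi\<close>.\<close>

lemma gen_in_span: "gen k \<in> span {c i * c j | i j. i + j = k}"
proof (induction k)
  case 0
  show ?case by (rule span_base) (auto simp: power2_eq_square)
next
  case (Suc k)
  have "deltat ` span {c i * c j | i j. i + j = k} = span (deltat ` {c i * c j | i j. i + j = k})"
    by (rule linear_span_image[OF linear_deltat, symmetric])
  also have "\<dots> \<subseteq> span {c i * c j | i j. i + j = Suc k}"
  proof (rule span_minimal)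
    show "deltat ` {c i * c j | i j. i + j = k} \<subseteq> span {c i * c j | i j. i + j = Suc k}"
    proof clarify
      fix i j assume k: "k = i + j"
      then have "c (Suc i) * c j \<in> {c i * c j | i j. i + j = Suc k}"
        "c i * c (Suc j) \<in> {c i * c j | i j. i + j = Suc k}"
        by (metis (mono_tags, lifting) add_Suc add_Suc_right mem_Collect_eq)+
      then show "deltat (c i * c j) \<in> span {c i' * c j' | i' j'. i' + j' = Suc (i + j)}"
        unfolding k by (simp add: deltat_mult span_add span_base)
    qed
  qed simp
  finally show ?case using Suc by auto
qed

section \<open>A functional vanishing on the ideal\<close>

text \<open>
  In degree 6 and order 5 modulo the ideal, the terms with two odd factors have dimension 5 and
  receive an injective \<open>d\<close> from the 4-dimensional space spanned by the monomials
  \<open>h\<^bsub>(0)\<^esub> h\<^bsub>(1)\<^esub> h\<^bsub>(2)\<^esub> c\<^bsub>(2)\<^esub>\<close>, \<open>h\<^bsub>(0)\<^esub> h\<^bsub>(1)\<^esub> h\<^bsub>(3)\<^esub> c\<^bsub>(1)\<^esub>\<close>, \<open>h\<^bsub>(0)\<^esub> h\<^bsub>(1)\<^esub> h\<^bsub>(4)\<^esub> c\<^bsub>(0)\<^esub>\<close> and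
  \<open>h\<^bsub>(0)\<^esub> h\<^bsub>(2)\<^esub> h\<^bsub>(3)\<^esub> c\<^bsub>(0)\<^esub>\<close>. Up to scaling, \<open>phi\<close> is the only functional there that
  vanishes on the image.
\<close>

definition phi :: "monom \<Rightarrow> real" where
  "phi = (\<lambda>(A, M).
     if fset A = {0, 1} then if M = {#1, 3#} then 3 else if M = {#2, 2#} then - 4 else 0
     else if fset A = {0, 2} then if M = {#0, 3#} then - 3 else if M = {#1, 2#} then 1 else 0
     else if fset A = {0, 3} then if M = {#0, 2#} then - 3 else if M = {#1, 1#} then 3 else 0
     else if fset A = {1, 2} then if M = {#0, 2#} then 5 else if M = {#1, 1#} then - 5 else 0
     else 0)"

lemma phi_eq_0_size:
  assumes "size M \<noteq> 2"
  shows "phi (A, M) = 0"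
proof -
  have "M \<noteq> {#x, y#}" for x y using assms by auto
  then show ?thesis by (simp add: phi_def)
qed

lemma monomial_c_c:
  "monomial (A, M) * (c i * c j) = monomial (A, add_mset i (add_mset j M))"
  by (simp add: c_def monomial_times add_mset_commute)

lemma mset_pair_eq_iff: "{#a, b#} = {#x, y#} \<longleftrightarrow> a = x \<and> b = y \<or> a = y \<and> b = x"
  by (subst add_eq_conv_ex) auto

lemma phi_pair_eq_0:
  assumes "i + j \<notin> {2, 3, 4}"
  shows "phi (A, {#i, j#}) = 0"
proof -
  have "{#i, j#} \<noteq> {#x, y#}" if "x + y \<in> {2, 3, 4}" for x y
    using assms that by (metis mset_pair_eq_iff add.commute)
  then show ?thesis by (simp add: phi_def)
qed

lemma phi_gen: "lin phi (x * gen k) = 0"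
proof (rule linear_eq_mono[of "\<lambda>x. lin phi (x * gen k)" "\<lambda>_. 0"])
  fix m :: monom
  obtain A M where m: "m = (A, M)" by (cases m)
  show "lin phi (monomial m * gen k) = 0"
  proof (cases "M = {#} \<and> k \<in> {2, 3, 4}")
    case True
    \<comment> \<open>The left-hand sides are the values of \<open>lin phi\<close> on the products
      of \<open>monomial (A, {#})\<close> with \<open>gen 2\<close>, \<open>gen 3\<close> and
      \<open>gen 4\<close>.\<close>
    have "2 * phi (A, {#0, 2#}) + 2 * phi (A, {#1, 1#}) = 0"
      "2 * phi (A, {#0, 3#}) + 6 * phi (A, {#1, 2#}) = 0"
      "2 * phi (A, {#0, 4#}) + 8 * phi (A, {#1, 3#}) + 6 * phi (A, {#2, 2#}) = 0"
      by (simp_all add: phi_def mset_pair_eq_iff doubleton_eq_iff)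
    with True show ?thesis
      by (auto simp: m gen_expansion distrib_left monomial_c_c linear_add[OF linear_lin]
          linear_scale[OF linear_lin])
  next
    case False
    \<comment> \<open>Either there are more than two even factors or their total order is outside 2
      to 4, and \<open>phi\<close> has no support there.\<close>
    have "linear (\<lambda>x. lin phi (monomial m * x))"
      using linear_compose[OF times_linear2 linear_lin] by (simp add: o_def)
    then show ?thesis
      by (rule linear_eq_0_on_span[OF _ _ gen_in_span])
        (use False in \<open>cases "M = {#}"; auto simp: m monomial_c_c phi_eq_0_size intro!: phi_pair_eq_0\<close>)
  qed
next
  show "linear (\<lambda>x. lin phi (x * gen k))"
    using linear_compose[OF times_linear1 linear_lin] by (simp add: o_def)
qed (rule linear_zero)

text \<open>Lets a generator move to the right end of \<open>x * gen k * y\<close>, so that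
  \<open>phi_gen\<close> covers the two-sided ideal.\<close>

lemma gen_central: "gen k * y = y * gen k"
proof (rule linear_eq_on[OF times_linear1 times_linear2 gen_in_span])
  fix s assume "s \<in> {c i * c j | i j. i + j = k}"
  then obtain i j where s: "s = c i * c j" by blast
  have "s * y = c i * (c j * y)" by (simp only: s mult.assoc)
  also have "\<dots> = y * c i * c j" by (simp only: c_commute[of j y] c_commute[of i y] flip: mult.assoc)
  finally show "s * y = y * s" by (simp only: s mult.assoc)
qed

lemma phi_dwI:
  assumes "x \<in> dwI"
  shows "lin phi x = 0"
proof (rule linear_eq_0_on_span[OF linear_lin])
  show "x \<in> span {x * s * y | x s y. s \<in> range gen}"
    using assms by (simp add: dwI_def ideal_gen_def)
  show "lin phi z = 0" if "z \<in> {x * s * y | x s y. s \<in> range gen}" for z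
  proof -
    obtain x k y where "z = x * gen k * y" using \<open>z \<in> _\<close> by blast
    then have "z = x * y * gen k" by (simp only: mult.assoc gen_central[of k y])
    then show ?thesis by (simp only: phi_gen)
  qed
qed

section \<open>Vanishing of the functional on coboundaries\<close>

lemma ksign_singleton: "ksign {i} A = (-1) ^ card (A \<inter> {..<i})"
proof -
  have "{(a, b). a \<in> {i} \<and> b \<in> A \<and> b < a} = Pair i ` (A \<inter> {..<i})" by auto
  then show ?thesis by (simp add: ksign_def ninv_def card_image inj_on_def)
qed

lemma dt_monomial:
  "dt (monomial (A, M)) =
    (\<Sum>i\<in>fset A. ksign {i} (fset A) *\<^sub>R monomial (A |-| {|i|}, add_mset i M))"
  unfolding dt_def der_def by (simp add: dh_mono c_def monomial_times)

lemma phi_dt_monomial: "lin phi (dt (monomial (A, {#j#}))) = 0"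
proof -
  let ?t = "\<lambda>i. ksign {i} (fset A) * phi (A |-| {|i|}, {#i, j#})"
  have "lin phi (dt (monomial (A, {#j#}))) = (\<Sum>i\<in>fset A. ?t i)"
    by (simp add: dt_monomial linear_sum[OF linear_lin] linear_scale[OF linear_lin])
  also have "\<dots> = 0"
  proof (cases "\<exists>i\<in>fset A. phi (A |-| {|i|}, {#i, j#}) \<noteq> 0")
    case True
    then obtain i where i: "i \<in> fset A" and nz: "phi (A |-| {|i|}, {#i, j#}) \<noteq> 0" by blast
    define B where "B = fset A - {i}"
    have A: "fset A = insert i B" "i \<notin> B" using i by (auto simp: B_def)
    \<comment> \<open>Since \<open>i\<close> is not in \<open>B\<close>, the support of
      \<open>phi\<close> leaves only the monomials listed before \<open>phi\<close> as the source of
      \<open>d\<close>. For \<open>{0, 1, 2}\<close> with \<open>j = 2\<close> the signed sum is 5 -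
      1 - 4.\<close>
    have "fset A = {0, 1, 2} \<and> j = 2 \<or> fset A = {0, 1, 3} \<and> j = 1 \<or>
        fset A = {0, 1, 4} \<and> j = 0 \<or> fset A = {0, 2, 3} \<and> j = 0"
      using nz A(2) unfolding A(1)
      by (simp add: phi_def mset_pair_eq_iff flip: B_def split: if_splits) auto
    then show ?thesis
      by (elim disjE conjE)
        (simp_all add: phi_def mset_pair_eq_iff ksign_singleton insert_Diff_if Int_insert_left
          insert_eq_iff doubleton_eq_iff)
  qed simp
  finally show ?thesis .
qed

lemma phi_dt: "lin phi (dt x) = 0"
proof (rule linear_eq_mono[of "\<lambda>x. lin phi (dt x)" "\<lambda>_. 0"])
  fix m :: monom
  obtain A M where m: "m = (A, M)" by (cases m)
  show "lin phi (dt (monomial m)) = 0"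
  \<comment> \<open>\<open>dt\<close> adds one even factor and \<open>phi\<close> is supported on
    exactly two.\<close>
  proof (cases "size M = 1")
    case True
    then obtain j where "M = {#j#}" using size_1_singleton_mset by blast
    then show ?thesis using phi_dt_monomial by (simp add: m)
  next
    case False
    then show ?thesis
      by (simp add: m dt_monomial linear_sum[OF linear_lin] linear_scale[OF linear_lin] phi_eq_0_size)
  qed
next
  show "linear (\<lambda>x. lin phi (dt x))"
    using linear_compose[OF linear_dt linear_lin] by (simp add: o_def)
qed (rule linear_zero)

section \<open>Non-triviality of the class of \<open>omega\<close>\<close>

abbreviation (input) omega :: dwt where
  "omega \<equiv> h 1 * h 2 * c 0 * c 2"

lemma omega_monomial: "omega = monomial ({|1, 2|}, {#0, 2#})"
  by (simp add: h_def c_def monomial_times ksign_singleton finsert_commute add_mset_commute)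

lemma cls_omega_nonzero: "cls (proj omega) \<noteq> 0"
proof
  assume "cls (proj omega) = 0"
  then have "cls (proj omega) = cls 0" by (simp add: cls_simps)
  then obtain z where "proj omega - 0 = d z"
    using h1h2c0c2_cocycle by (subst (asm) cls_eq_iff) auto
  moreover obtain y where "z = proj y"
    using Quotient_abs_rep[OF Quotient_dw] by metis
  ultimately have "omega - dt y \<in> dwI" by (simp add: proj_eq_iff flip: proj_simps)
  then have "lin phi (omega - dt y) = 0" by (rule phi_dwI)
  then have "lin phi omega = 0" by (simp add: linear_diff[OF linear_lin] phi_dt)
  then show False
    unfolding omega_monomial by (simp add: phi_def insert_eq_iff doubleton_eq_iff)
qed

section \<open>Products of the iterated \<open>delta\<close>-images of \<open>GV\<close>\<close>

text \<open>The cocycle condition is carried through the induction because \<open>delta_cls\<close>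
  requires it.\<close>

lemma delta_GV: "d (proj ((deltat ^^ k) (h 0 * c 0))) = 0 \<and>
    (delta ^^ k) GV = cls (proj ((deltat ^^ k) (h 0 * c 0)))"
proof (induction k)
  case 0
  show ?case using GV_cocycle by (simp add: GV_def)
next
  case (Suc k)
  then show ?case by (simp add: delta_cls proj_simps d_deltaq)
qed

lemma deltat_h0c0_expansion:
  "(deltat ^^ 1) (h 0 * c 0) = h 0 * c 1 + h 1 * c 0"
  "(deltat ^^ 2) (h 0 * c 0) = h 0 * c 2 + 2 *\<^sub>R (h 1 * c 1) + h 2 * c 0"
  "(deltat ^^ 3) (h 0 * c 0) = h 0 * c 3 + 3 *\<^sub>R (h 1 * c 2) + 3 *\<^sub>R (h 2 * c 1) + h 3 * c 0"
  "(deltat ^^ 4) (h 0 * c 0) =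
     h 0 * c 4 + 4 *\<^sub>R (h 1 * c 3) + 6 *\<^sub>R (h 2 * c 2) + 4 *\<^sub>R (h 3 * c 1) + h 4 * c 0"
proof -
  have step: "(deltat ^^ Suc k) x = deltat ((deltat ^^ k) x)" for k x by simp
  show 1: "(deltat ^^ 1) (h 0 * c 0) = h 0 * c 1 + h 1 * c 0"
    by (simp add: deltat_mult)
  show 2: "(deltat ^^ 2) (h 0 * c 0) = h 0 * c 2 + 2 *\<^sub>R (h 1 * c 1) + h 2 * c 0"
    using step[of 1 "h 0 * c 0"] unfolding 1
    by (simp add: deltat_mult scaleR_2 flip: numeral_2_eq_2)
  have three: "Suc 2 = 3" and four: "Suc 3 = 4" by simp_all
  \<comment> \<open>From here on, comparing coefficients turns the collection of like terms into
    real arithmetic.\<close>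
  show 3: "(deltat ^^ 3) (h 0 * c 0) =
      h 0 * c 3 + 3 *\<^sub>R (h 1 * c 2) + 3 *\<^sub>R (h 2 * c 1) + h 3 * c 0"
    using step[of 2 "h 0 * c 0"] unfolding 2 three
    by (intro dwt_eqI) (simp add: deltat_mult flip: numeral_2_eq_2)
  show "(deltat ^^ 4) (h 0 * c 0) =
     h 0 * c 4 + 4 *\<^sub>R (h 1 * c 3) + 6 *\<^sub>R (h 2 * c 2) + 4 *\<^sub>R (h 3 * c 1) + h 4 * c 0"
    using step[of 3 "h 0 * c 0"] unfolding 3 four
    by (intro dwt_eqI) (simp add: deltat_mult flip: numeral_2_eq_2)
qed

lemma gen_dwI: "gen k \<in> dwI"
  using dwI_gen[of 1 k 1] by simp

lemma cls_proj_eqI: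
  assumes "d (proj x) = 0" "d (proj y) = 0" "x = y + dt z + r" "r \<in> dwI"
  shows "cls (proj x) = cls (proj y)"
proof -
  have "proj r = 0" using assms(4) by (metis proj_eq_iff diff_zero proj_simps(1))
  then have "proj x - proj y = d (proj z)" by (simp add: assms(3) proj_simps)
  then show ?thesis using assms by (auto simp: cls_eq_iff)
qed

lemma delta_GV_product_eqI:
  assumes "(deltat ^^ i) (h 0 * c 0) * (deltat ^^ j) (h 0 * c 0) = a *\<^sub>R omega + dt z + r" "r \<in> dwI"
  shows "(delta ^^ i) GV * (delta ^^ j) GV = a *\<^sub>R cls (proj omega)"
proof -
  let ?x = "\<lambda>k. (deltat ^^ k) (h 0 * c 0)"
  have "cls (proj (?x i * ?x j)) = cls (proj (a *\<^sub>R omega))"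
    by (rule cls_proj_eqI[OF _ _ assms])
      (use delta_GV h1h2c0c2_cocycle in \<open>simp_all add: proj_simps d_mult\<close>)
  then show ?thesis
    using delta_GV h1h2c0c2_cocycle by (simp add: cls_simps proj_simps)
qed

lemma delta1_GV_delta4_GV: "(delta ^^ 1) GV * (delta ^^ 4) GV = 12 *\<^sub>R cls (proj omega)"
proof (rule delta_GV_product_eqI)
  \<comment> \<open>The factor 12 is forced: \<open>lin phi\<close> is 60 on the product, 5 on
    \<open>omega\<close> and 0 on the other two summands. Then \<open>?z\<close> and
    \<open>?r\<close> solve a linear system.\<close>
  let ?z = "- 6 *\<^sub>R (h 0 * h 1 * h 2 * c 2) - 4 *\<^sub>R (h 0 * h 1 * h 3 * c 1) - 3 *\<^sub>R (h 0 * h 1 * h 4 * c 0)"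
  let ?r = "h 0 * h 1 * gen 4 + 4 *\<^sub>R (h 1 * h 3 * gen 1) + 4 *\<^sub>R (h 1 * h 4 * gen 0) - h 0 * h 4 * gen 1"
  show "(deltat ^^ 1) (h 0 * c 0) * (deltat ^^ 4) (h 0 * c 0) = 12 *\<^sub>R omega + dt ?z + ?r"
    unfolding deltat_h0c0_expansion gen_expansion
    by (rule dwt_eqI) (simp add: dt_mult par_mult c_h_normal h_normal mult.assoc distrib_left distrib_right
      left_diff_distrib right_diff_distrib)
  show "?r \<in> dwI" by (intro dwI_add dwI_diff dwI_scale dwI_timesL gen_dwI)
qed

lemma delta2_GV_delta3_GV: "(delta ^^ 2) GV * (delta ^^ 3) GV = - 12 *\<^sub>R cls (proj omega)"
proof (rule delta_GV_product_eqI)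
  \<comment> \<open>Likewise \<open>lin phi\<close> is -60 on this product, which forces
    -12.\<close>
  let ?z = "3 *\<^sub>R (h 0 * h 1 * h 2 * c 2) - 2 *\<^sub>R (h 0 * h 1 * h 3 * c 1) - 3 *\<^sub>R (h 0 * h 2 * h 3 * c 0)"
  let ?r = "4 *\<^sub>R (h 2 * h 3 * gen 0) + 2 *\<^sub>R (h 1 * h 3 * gen 1) + h 0 * h 2 * gen 3
    - h 0 * h 3 * gen 2 + 3 *\<^sub>R (h 1 * h 2 * gen 2)"
  show "(deltat ^^ 2) (h 0 * c 0) * (deltat ^^ 3) (h 0 * c 0) = - 12 *\<^sub>R omega + dt ?z + ?r"
    unfolding deltat_h0c0_expansion gen_expansion
    by (rule dwt_eqI) (simp add: dt_mult par_mult c_h_normal h_normal mult.assoc distrib_left distrib_right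
      left_diff_distrib right_diff_distrib)
  show "?r \<in> dwI" by (intro dwI_add dwI_diff dwI_scale dwI_timesL gen_dwI)
qed

lemma sigmaq_omega: "sigmaq (proj omega) = 0"
proof -
  \<comment> \<open>\<open>sigmat\<close> kills \<open>h 1\<close> and \<open>c 0\<close>, and
    replacing \<open>h 2\<close> by \<open>h 1\<close> gives a square of an odd generator, so only
    the change from \<open>c 2\<close> to \<open>c 1\<close> survives.\<close>
  have "sigmat omega = (1/2) *\<^sub>R (h 1 * h 2 * gen 1)"
    unfolding gen_expansion by (simp add: sigmat_mult mult.assoc distrib_left)
  also have "\<dots> \<in> dwI" by (intro dwI_scale dwI_timesL gen_dwI)
  finally show ?thesis
    by (metis proj_eq_iff diff_zero proj_simps(1,10))
qed

lemma scaleR_omega_in_F05: "a *\<^sub>R cls (proj omega) \<in> F05"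
proof -
  have "a *\<^sub>R cls (proj omega) = cls (proj (a *\<^sub>R omega))" "d (proj (a *\<^sub>R omega)) = 0"
    using h1h2c0c2_cocycle by (simp_all add: cls_simps proj_simps)
  moreover have "coeff (a *\<^sub>R omega) m \<noteq> 0 \<longrightarrow> monom_ord m = 5" for m
    unfolding omega_monomial by (simp add: coeff_mono monom_ord_def)
  ultimately have "a *\<^sub>R cls (proj omega) \<in> hdw_ord 5"
    unfolding hdw_ord_def by blast
  moreover have "sigma (a *\<^sub>R cls (proj omega)) = 0"
    using h1h2c0c2_cocycle sigmaq_omega
    by (simp add: cls_simps sigma_cls)
  moreover have "delta 0 = 0"
    using delta_cls[of 0] by (simp add: cls_simps)
  ultimately show ?thesis by (simp add: F05_def eigenspace_def)
qed

theorem theorem10p8: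
  "delta GV * (delta ^^ 4) GV \<in> F05 \<and>
   (delta ^^ 2) GV * (delta ^^ 3) GV \<in> F05 \<and>
   (\<exists>a::real. delta GV * (delta ^^ 4) GV = a *\<^sub>R cls (proj (h 1 * h 2 * c 0 * c 2))) \<and>
   (\<exists>b::real. (delta ^^ 2) GV * (delta ^^ 3) GV = b *\<^sub>R cls (proj (h 1 * h 2 * c 0 * c 2))) \<and>
   cls (proj (h 1 * h 2 * c 0 * c 2)) \<noteq> 0 \<and>
   delta GV * (delta ^^ 4) GV \<noteq> 0 \<and>
   (delta ^^ 2) GV * (delta ^^ 3) GV \<noteq> 0"
proof -
  have "delta GV * (delta ^^ 4) GV = 12 *\<^sub>R cls (proj omega)"
    using delta1_GV_delta4_GV by simp
  then show ?thesis
    using delta2_GV_delta3_GV cls_omega_nonzero scaleR_omega_in_F05 by (auto simp del: scaleR_minus_left)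
qed

end
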